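(* Let $M$ be a pseudo-Riemannian hyperquadric of dimension $n\geq2$ and curvature $\epsilon=\pm1$, and let $\sigma$ be a non-trivial preharmonic Killing field on $M$ with linear extension $A$. Put $F=\frac12\langle\sigma,\sigma\rangle$, let $\hat\sigma$ be the Killing field on $M$ with linear extension $A^3$, and let $\lambda\in\mathbb{R}$ be the constant with $\hat\sigma=\lambda\sigma$, characterised by $2F\lambda=\langle\sigma,\hat\sigma\rangle$. Then for $p,q\in\mathbb{R}$, $\sigma$ is $(p,q)$-harmonic if and only if $$0=\epsilon(n+1-p)q\,(2F)^2+\bigl(\epsilon(n-1+(n+1)q)-pq\lambda-q\langle A,A\rangle\bigr)(2F)+\epsilon(n-1)-2p\lambda-(p+q)\langle A,A\rangle$$ identically on $M$.
   Context: $\mathbb{R}^{n+1}_u$ denotes $\mathbb{R}^{n+1}$ with inner product $\langle x,y\rangle=x_1y_1+\cdots+x_{n+1-u}y_{n+1-u}-\cdots-x_{n+1}y_{n+1}$ of index $u$. For $n\geq2$, $0\leq v\leq n$: $S^n_v=\{x\in\mathbb{R}^{n+1}_v:\langle x,x\rangle=1\}$ (curvature $\epsilon=1$) and $H^n_v=\{x\in\mathbb{R}^{n+1}_{v+1}:\langle x,x\rangle=-1\}$ (curvature $\epsilon=-1$), with induced metrics; these are the pseudo-Riemannian hyperquadrics, and the ambient space is denoted $\mathbb{V}$. Each Killing field $\sigma$ on $M$ is the restriction to $M$ of a unique skew-symmetric linear map $A\colon\mathbb{V}\to\mathbb{V}$ ($\langle Ax,y\rangle=-\langle x,Ay\rangle$),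 called its linear extension: $\sigma(x)=A(x)$. Also $\langle A,A\rangle=\sum_i\epsilon_i\langle A(e_i),A(e_i)\rangle$ for any orthonormal basis $\{e_i\}$ of $\mathbb{V}$ with $\epsilon_i=\langle e_i,e_i\rangle=\pm1$. Let $\sigma$ be a vector field on a pseudo-Riemannian manifold $(M,g=\langle\cdot,\cdot\rangle)$ with Levi-Civita connection $\nabla$, $F=\frac12\langle\sigma,\sigma\rangle$, $\nabla F=\operatorname{grad}F$, $\Delta F=-\operatorname{div}\nabla F$. For a local orthonormal frame $\{E_i\}$ with $\epsilon_i=\langle E_i,E_i\rangle=\pm1$ put $\langle\nabla\sigma,\nabla\sigma\rangle=\sum_i\epsilon_i\langle\nabla_{E_i}\sigma,\nabla_{E_i}\sigma\rangle$ and $\nabla^*\nabla\sigma=-\sum_i\epsilon_i\nabla^2_{E_i,E_i}\sigma$. Then $\sigma$ is $(p,q)$-harmonic if $\tau_{p,q}(\sigma)=0$ identically on $M$, where $$\tau_{p,q}(\sigma)=(1+2F)\nabla^*\nabla\sigma+2p\nabla_{\nabla F}\sigma-\bigl(p\langle\nabla\sigma,\nabla\sigma\rangle-pq\,g(\nabla F,\nabla F)-q(1+2F)\Delta F\bigr)\sigma .$$ $\sigma$ is preharmonic if there exist smooth functions $\nu,\zeta\colon M\to\mathbb{R}$ with $\nabla^*\nabla\sigma=\nu\sigma$ and $\nabla_{\nabla F}\sigma=\zeta\sigma$ (equivalently, $(1+2F)\nabla^*\nabla\sigma+2p\nabla_{\nabla F}\sigma$ is pointwise collinear with $\sigma$ for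 all $p$). For a preharmonic Killing field on a hyperquadric there is a real constant $\lambda$ with $\hat\sigma=\lambda\sigma$. *)

theory Defs
  imports "HOL-Analysis.Analysis"
begin

section \<open>The ambient space of index \<open>u\<close> and the hyperquadrics\<close>

text \<open>
  The coordinates of \<open>real ^ 'm\<close> are enumerated increasingly by the linear order on the
  finite index type \<open>'m\<close>; the last \<open>u\<close> of them carry a minus sign.
\<close>

type_synonym 'm ambient = "(real, 'm) vec"

definition coord_sign :: "nat \<Rightarrow> 'm::{finite,linorder} \<Rightarrow> real" where
  "coord_sign u i = (if card {j. j \<le> i} \<le> CARD('m) - u then 1 else - 1)"

definition scal :: "nat \<Rightarrow> 'm::{finite,linorder} ambient \<Rightarrow> 'm ambient \<Rightarrow> real" where
  "scal u x y = (\<Sum>i\<in>UNIV. coord_sign u i * (x $ i) * (y $ i))"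

definition pseudo_sphere :: "nat \<Rightarrow> 'm::{finite,linorder} ambient set" where
  "pseudo_sphere v = {x. scal v x x = 1}"

definition pseudo_hyperbolic :: "nat \<Rightarrow> 'm::{finite,linorder} ambient set" where
  "pseudo_hyperbolic v = {x. scal (v + 1) x x = - 1}"

text \<open>The tangent space at \<open>x\<close> of a hyperquadric \<open>{x. scal u x x = const}\<close>, as a subspace of
  the ambient space; the induced metric is the restriction of \<open>scal u\<close>.\<close>

definition tangent :: "nat \<Rightarrow> 'm::{finite,linorder} ambient \<Rightarrow> 'm ambient set" where
  "tangent u x = {w. scal u x w = 0}"

definition orthonormal_basis ::
    "nat \<Rightarrow> 'm::{finite,linorder} ambient set \<Rightarrow> 'm ambient set \<Rightarrow> bool" where
  "orthonormal_basis u W B \<longleftrightarrow>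
     finite B \<and> B \<subseteq> W \<and> span B = W \<and>
     (\<forall>b\<in>B. scal u b b = 1 \<or> scal u b b = - 1) \<and>
     (\<forall>b\<in>B. \<forall>c\<in>B. b \<noteq> c \<longrightarrow> scal u b c = 0)"

text \<open>\<open>metric_trace u W T\<close> is the sum of \<open>\<epsilon>\<^sub>i T(e\<^sub>i, e\<^sub>i)\<close> over any orthonormal basis of the
  (nondegenerate) subspace \<open>W\<close>; it is independent of the basis for bilinear \<open>T\<close>.\<close>

definition metric_trace ::
    "nat \<Rightarrow> 'm::{finite,linorder} ambient set \<Rightarrow> ('m ambient \<Rightarrow> 'm ambient \<Rightarrow> 'b::real_vector) \<Rightarrow> 'b"
  where
  "metric_trace u W T =
     (THE s. \<forall>B. orthonormal_basis u W B \<longrightarrow> s = (\<Sum>b\<in>B. scal u b b *\<^sub>R T b b))"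


section \<open>Smooth functions and vector fields on a submanifold\<close>

primrec Ck_on ::
    "nat \<Rightarrow> ('a::real_normed_vector \<Rightarrow> 'b::real_normed_vector) \<Rightarrow> 'a set \<Rightarrow> bool" where
  "Ck_on 0 f U \<longleftrightarrow> continuous_on U f"
| "Ck_on (Suc k) f U \<longleftrightarrow>
     (\<forall>x\<in>U. f differentiable (at x)) \<and>
     (\<forall>w. Ck_on k (\<lambda>x. frechet_derivative f (at x) w) U)"

definition Cinf_on ::
    "('a::real_normed_vector \<Rightarrow> 'b::real_normed_vector) \<Rightarrow> 'a set \<Rightarrow> bool" where
  "Cinf_on f U \<longleftrightarrow> (\<forall>k. Ck_on k f U)"

text \<open>\<open>local_ext M f x U g\<close>: near \<open>x\<close>, \<open>f\<close> restricted to \<open>M\<close> extends to the smooth map \<open>g\<close> on the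
  open set \<open>U\<close> of the ambient space. Functions and fields on \<open>M\<close> are total functions on the ambient
  space of which only the values on \<open>M\<close> are relevant.\<close>

definition local_ext ::
    "'a::real_normed_vector set \<Rightarrow> ('a \<Rightarrow> 'b::real_normed_vector) \<Rightarrow> 'a \<Rightarrow> 'a set \<Rightarrow> ('a \<Rightarrow> 'b) \<Rightarrow> bool"
  where
  "local_ext M f x U g \<longleftrightarrow> open U \<and> x \<in> U \<and> Cinf_on g U \<and> (\<forall>y\<in>U \<inter> M. g y = f y)"

definition smooth_fun ::
    "'a::real_normed_vector set \<Rightarrow> ('a \<Rightarrow> 'b::real_normed_vector) \<Rightarrow> bool" where
  "smooth_fun M f \<longleftrightarrow> (\<forall>x\<in>M. \<exists>U g. local_ext M f x U g)"

definition vector_field ::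
    "nat \<Rightarrow> 'm::{finite,linorder} ambient set \<Rightarrow> ('m ambient \<Rightarrow> 'm ambient) \<Rightarrow> bool" where
  "vector_field u M X \<longleftrightarrow> smooth_fun M X \<and> (\<forall>x\<in>M. X x \<in> tangent u x)"

text \<open>The derivative \<open>w(f)\<close> of a smooth real function \<open>f\<close> on \<open>M\<close> along a tangent vector \<open>w\<close> at \<open>x\<close>.\<close>

definition tderiv ::
    "'a::real_normed_vector set \<Rightarrow> ('a \<Rightarrow> real) \<Rightarrow> 'a \<Rightarrow> 'a \<Rightarrow> real" where
  "tderiv M f x w =
     (THE d. \<exists>U g. local_ext M f x U g \<and> d = frechet_derivative g (at x) w)"

text \<open>\<open>Z = [X, Y]\<close>, that is, \<open>Z f = X (Y f) - Y (X f)\<close> for all smooth \<open>f\<close>.\<close>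

definition is_lie_bracket ::
    "nat \<Rightarrow> 'm::{finite,linorder} ambient set \<Rightarrow> ('m ambient \<Rightarrow> 'm ambient) \<Rightarrow>
     ('m ambient \<Rightarrow> 'm ambient) \<Rightarrow> ('m ambient \<Rightarrow> 'm ambient) \<Rightarrow> bool" where
  "is_lie_bracket u M X Y Z \<longleftrightarrow>
     vector_field u M Z \<and>
     (\<forall>f. smooth_fun M f \<longrightarrow>
        (\<forall>x\<in>M. tderiv M f x (Z x) =
           tderiv M (\<lambda>y. tderiv M f y (Y y)) x (X x) - tderiv M (\<lambda>y. tderiv M f y (X y)) x (Y x)))"


section \<open>Levi-Civita connection and Killing fields\<close>

type_synonym 'm connection =
  "('m ambient \<Rightarrow> 'm ambient) \<Rightarrow> 'm ambient \<Rightarrow> 'm ambient \<Rightarrow> 'm ambient"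

text \<open>A connection is written \<open>D Y x w\<close> for the covariant derivative at \<open>x\<close> of the field \<open>Y\<close> in the
  direction of the tangent vector \<open>w\<close>. The clauses are: smoothness, linearity in the direction,
  additivity and the Leibniz rule in the field, compatibility with the metric, vanishing torsion.\<close>

definition levi_civita ::
    "nat \<Rightarrow> 'm::{finite,linorder} ambient set \<Rightarrow>
     'm connection \<Rightarrow> bool" where
  "levi_civita u M D \<longleftrightarrow>
     (\<forall>X Y. vector_field u M X \<longrightarrow> vector_field u M Y \<longrightarrow>
        vector_field u M (\<lambda>x. D Y x (X x))) \<and>
     (\<forall>Y. vector_field u M Y \<longrightarrow>
        (\<forall>x\<in>M. \<forall>w\<in>tangent u x. \<forall>z\<in>tangent u x. \<forall>a b.
           D Y x (a *\<^sub>R w + b *\<^sub>R z) = a *\<^sub>R D Y x w + b *\<^sub>R D Y x z)) \<and>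
     (\<forall>Y Z. vector_field u M Y \<longrightarrow> vector_field u M Z \<longrightarrow>
        (\<forall>x\<in>M. \<forall>w\<in>tangent u x. D (\<lambda>y. Y y + Z y) x w = D Y x w + D Z x w)) \<and>
     (\<forall>f Y. smooth_fun M f \<longrightarrow> vector_field u M Y \<longrightarrow>
        (\<forall>x\<in>M. \<forall>w\<in>tangent u x.
           D (\<lambda>y. f y *\<^sub>R Y y) x w = tderiv M f x w *\<^sub>R Y x + f x *\<^sub>R D Y x w)) \<and>
     (\<forall>Y Z. vector_field u M Y \<longrightarrow> vector_field u M Z \<longrightarrow>
        (\<forall>x\<in>M. \<forall>w\<in>tangent u x.
           tderiv M (\<lambda>y. scal u (Y y) (Z y)) x w = scal u (D Y x w) (Z x) + scal u (Y x) (D Z x w))) \<and>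
     (\<forall>X Y. vector_field u M X \<longrightarrow> vector_field u M Y \<longrightarrow>
        is_lie_bracket u M X Y (\<lambda>x. D Y x (X x) - D X x (Y x)))"

text \<open>The Lie derivative of the metric along \<open>\<sigma>\<close> vanishes:
  \<open>\<sigma>\<langle>X, Y\<rangle> = \<langle>[\<sigma>, X], Y\<rangle> + \<langle>X, [\<sigma>, Y]\<rangle>\<close>.\<close>

definition killing_field ::
    "nat \<Rightarrow> 'm::{finite,linorder} ambient set \<Rightarrow> ('m ambient \<Rightarrow> 'm ambient) \<Rightarrow> bool" where
  "killing_field u M \<sigma> \<longleftrightarrow>
     vector_field u M \<sigma> \<and>
     (\<forall>X Y P Q. vector_field u M X \<longrightarrow> vector_field u M Y \<longrightarrow>
        is_lie_bracket u M \<sigma> X P \<longrightarrow> is_lie_bracket u M \<sigma> Y Q \<longrightarrow>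
        (\<forall>x\<in>M. tderiv M (\<lambda>y. scal u (X y) (Y y)) x (\<sigma> x) =
           scal u (P x) (Y x) + scal u (X x) (Q x)))"

definition linear_extension ::
    "nat \<Rightarrow> 'm::{finite,linorder} ambient set \<Rightarrow> ('m ambient \<Rightarrow> 'm ambient) \<Rightarrow>
     ('m ambient \<Rightarrow> 'm ambient) \<Rightarrow> bool" where
  "linear_extension u M \<sigma> A \<longleftrightarrow>
     linear A \<and> (\<forall>x y. scal u (A x) y = - scal u x (A y)) \<and> (\<forall>x\<in>M. \<sigma> x = A x)"

definition norm2_map :: "nat \<Rightarrow> ('m::{finite,linorder} ambient \<Rightarrow> 'm ambient) \<Rightarrow> real" where
  "norm2_map u A = metric_trace u UNIV (\<lambda>x y. scal u (A x) (A y))"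


section \<open>Differential operators and \<open>(p,q)\<close>-harmonicity\<close>

text \<open>\<open>M\<close> is the manifold, \<open>u\<close> the index of the ambient space, \<open>D\<close> its Levi-Civita connection.\<close>

definition grad ::
    "nat \<Rightarrow> 'm::{finite,linorder} ambient set \<Rightarrow> ('m ambient \<Rightarrow> real) \<Rightarrow> 'm ambient \<Rightarrow> 'm ambient" where
  "grad u M f x = (THE z. z \<in> tangent u x \<and> (\<forall>w\<in>tangent u x. scal u z w = tderiv M f x w))"

definition divergence ::
    "nat \<Rightarrow> 'm::{finite,linorder} connection \<Rightarrow>
     ('m ambient \<Rightarrow> 'm ambient) \<Rightarrow> 'm ambient \<Rightarrow> real" where
  "divergence u D X x = metric_trace u (tangent u x) (\<lambda>w z. scal u (D X x w) z)"

definition laplacian ::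
    "nat \<Rightarrow> 'm::{finite,linorder} ambient set \<Rightarrow>
     'm connection \<Rightarrow>
     ('m ambient \<Rightarrow> real) \<Rightarrow> 'm ambient \<Rightarrow> real" where
  "laplacian u M D f x = - divergence u D (grad u M f) x"

text \<open>The second covariant derivative of \<open>\<sigma>\<close> at \<open>x\<close> on tangent vectors \<open>w\<close>, \<open>z\<close>:
  \<open>D\<^sub>w (D\<^sub>Z \<sigma>) - D\<^bsub>D\<^sub>w Z\<^esub> \<sigma>\<close> for any vector field \<open>Z\<close> extending \<open>z\<close>.\<close>

definition second_cov ::
    "nat \<Rightarrow> 'm::{finite,linorder} ambient set \<Rightarrow>
     'm connection \<Rightarrow>
     ('m ambient \<Rightarrow> 'm ambient) \<Rightarrow> 'm ambient \<Rightarrow> 'm ambient \<Rightarrow> 'm ambient \<Rightarrow> 'm ambient" where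
  "second_cov u M D \<sigma> x w z =
     (THE s. \<forall>Z. vector_field u M Z \<and> Z x = z \<longrightarrow>
        s = D (\<lambda>y. D \<sigma> y (Z y)) x w - D \<sigma> x (D Z x w))"

definition rough_laplacian ::
    "nat \<Rightarrow> 'm::{finite,linorder} ambient set \<Rightarrow>
     'm connection \<Rightarrow>
     ('m ambient \<Rightarrow> 'm ambient) \<Rightarrow> 'm ambient \<Rightarrow> 'm ambient" where
  "rough_laplacian u M D \<sigma> x = - metric_trace u (tangent u x) (second_cov u M D \<sigma> x)"

definition norm2_cov ::
    "nat \<Rightarrow> 'm::{finite,linorder} connection \<Rightarrow>
     ('m ambient \<Rightarrow> 'm ambient) \<Rightarrow> 'm ambient \<Rightarrow> real" where
  "norm2_cov u D \<sigma> x = metric_trace u (tangent u x) (\<lambda>w z. scal u (D \<sigma> x w) (D \<sigma> x z))"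

definition half_norm2 ::
    "nat \<Rightarrow> ('m::{finite,linorder} ambient \<Rightarrow> 'm ambient) \<Rightarrow> 'm ambient \<Rightarrow> real" where
  "half_norm2 u \<sigma> x = 1 / 2 * scal u (\<sigma> x) (\<sigma> x)"

definition tau ::
    "nat \<Rightarrow> 'm::{finite,linorder} ambient set \<Rightarrow>
     'm connection \<Rightarrow>
     real \<Rightarrow> real \<Rightarrow> ('m ambient \<Rightarrow> 'm ambient) \<Rightarrow> 'm ambient \<Rightarrow> 'm ambient" where
  "tau u M D p q \<sigma> x =
     (let F = half_norm2 u \<sigma>; G = grad u M F x in
      (1 + 2 * F x) *\<^sub>R rough_laplacian u M D \<sigma> x + (2 * p) *\<^sub>R D \<sigma> x G
      - (p * norm2_cov u D \<sigma> x - p * q * scal u G G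
         - q * (1 + 2 * F x) * laplacian u M D F x) *\<^sub>R \<sigma> x)"

definition pq_harmonic ::
    "nat \<Rightarrow> 'm::{finite,linorder} ambient set \<Rightarrow>
     'm connection \<Rightarrow>
     real \<Rightarrow> real \<Rightarrow> ('m ambient \<Rightarrow> 'm ambient) \<Rightarrow> bool" where
  "pq_harmonic u M D p q \<sigma> \<longleftrightarrow> (\<forall>x\<in>M. tau u M D p q \<sigma> x = 0)"

definition preharmonic ::
    "nat \<Rightarrow> 'm::{finite,linorder} ambient set \<Rightarrow>
     'm connection \<Rightarrow>
     ('m ambient \<Rightarrow> 'm ambient) \<Rightarrow> bool" where
  "preharmonic u M D \<sigma> \<longleftrightarrow>
     (\<exists>\<nu> \<zeta>. smooth_fun M \<nu> \<and> smooth_fun M \<zeta> \<and>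
        (\<forall>x\<in>M. rough_laplacian u M D \<sigma> x = (\<nu> x :: real) *\<^sub>R \<sigma> x \<and>
           D \<sigma> x (grad u M (half_norm2 u \<sigma>) x) = (\<zeta> x :: real) *\<^sub>R \<sigma> x))"

end

theory Submission
  imports Defs
begin

text \<open>
  Every term of \<open>\<tau>\<^sub>p\<^sub>,\<^sub>q(\<sigma>)\<close> can be computed in the ambient space. Write \<open>A\<close> for the linear
  extension of \<open>\<sigma>\<close> and \<open>t = \<langle>Ax, Ax\<rangle> = 2F(x)\<close>. The Levi-Civita connection of the hyperquadric is
  \<open>\<nabla>\<^sub>w Y = dY(w) + \<epsilon>\<langle>Y, w\<rangle>x\<close>, the tangential part of the ambient derivative
  (\<open>levi_civita_eq\<close>), and skew-symmetry of \<open>A\<close> then gives, at each point \<open>x\<close>,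

    \<^item> \<open>\<nabla>\<^sub>w\<sigma> = Aw + \<epsilon>\<langle>Ax, w\<rangle>x\<close>,
    \<^item> \<open>\<nabla>\<^sup>*\<nabla>\<sigma> = \<epsilon>(n - 1)\<sigma>\<close>,
    \<^item> \<open>\<langle>\<nabla>\<sigma>, \<nabla>\<sigma>\<rangle> = \<langle>A, A\<rangle> - 2\<epsilon>t\<close>,
    \<^item> \<open>\<nabla>F = - A\<^sup>2x - \<epsilon>tx\<close>,
    \<^item> \<open>\<Delta>F = \<epsilon>(n + 1)t - \<langle>A, A\<rangle>\<close>.

  The condition \<open>A\<^sup>3x = \<lambda>Ax\<close> on the hyperquadric enters through
  \<open>\<nabla>\<^bsub>\<nabla>F\<^esub>\<sigma> = - A\<^sup>3x - \<epsilon>tAx = - (\<lambda> + \<epsilon>t)\<sigma>\<close> and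
  \<open>\<langle>\<nabla>F, \<nabla>F\<rangle> = - \<lambda>t - \<epsilon>t\<^sup>2\<close>. Substituting, \<open>\<tau>\<^sub>p\<^sub>,\<^sub>q(\<sigma>) = P(2F)\<sigma>\<close>, where \<open>P\<close> is the
  polynomial on the right-hand side of the theorem (\<open>tau_killing\<close>).

  So \<open>\<tau>\<^sub>p\<^sub>,\<^sub>q(\<sigma>) = 0\<close> says that \<open>P(2F)\<close> vanishes where \<open>\<sigma>\<close> does not. The points with
  \<open>\<sigma> \<noteq> 0\<close> are dense: if \<open>Ax = 0\<close>, some tangent vector \<open>w\<close> at \<open>x\<close> has \<open>Aw \<noteq> 0\<close>, because \<open>x\<close>
  and its tangent space span the ambient space and \<open>A \<noteq> 0\<close>, and \<open>A\<close> is nonzero along a curve that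
  leaves \<open>x\<close> in the direction \<open>w\<close>. By continuity \<open>P(2F)\<close> vanishes everywhere
  (\<open>continuous_eq_0_at_zeros\<close>).

  The operators are defined by unique descriptions, which accounts for the rest of the work: metric
  traces need orthonormal bases and independence of the basis, derivatives along tangent vectors
  must not depend on the local extension, and the connection is identified from its axioms by the
  symmetry argument behind the Koszul formula.
\<close>

section \<open>The ambient scalar product\<close>

lemma bounded_bilinear_scal: "bounded_bilinear (scal u)"
proof -
  have "bilinear (scal u)"
    unfolding bilinear_def scal_def
    by (auto intro!: linearI simp: algebra_simps sum.distrib sum_distrib_left)
  then show ?thesis
    by (simp add: bilinear_conv_bounded_bilinear)
qed

interpretation scal: bounded_bilinear "scal u" for u
  by (rule bounded_bilinear_scal)

lemma scal_commute: "scal u x y = scal u y x"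
  unfolding scal_def by (simp add: mult.commute mult.left_commute)

lemma scal_nondegenerate:
  assumes "\<And>y. scal u x y = 0"
  shows "x = 0"
proof (simp add: vec_eq_iff, intro allI)
  fix i
  have "scal u x (axis i 1) = (\<Sum>j\<in>UNIV. if j = i then coord_sign u i * (x $ i) else 0)"
    unfolding scal_def by (rule sum.cong) (auto simp: axis_def)
  also have "\<dots> = coord_sign u i * (x $ i)"
    by simp
  finally show "x $ i = 0"
    using assms by (auto simp: coord_sign_def split: if_splits)
qed

lemma subspace_tangent: "subspace (tangent u x)"
  by (auto simp: subspace_def tangent_def scal.add_right scal.scaleR_right scal.zero_right)


section \<open>Orthonormal bases and metric traces\<close>

lemma orthonormal_expansion:
  assumes B: "finite B" "\<And>b. b \<in> B \<Longrightarrow> scal u b b = 1 \<or> scal u b b = - 1"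
    "\<And>b c. b \<in> B \<Longrightarrow> c \<in> B \<Longrightarrow> b \<noteq> c \<Longrightarrow> scal u b c = 0"
    and x: "x \<in> span B"
  shows "x = (\<Sum>b\<in>B. (scal u b b * scal u x b) *\<^sub>R b)"
proof -
  from x obtain r where r: "x = (\<Sum>b\<in>B. r b *\<^sub>R b)"
    using B(1) by (auto simp: span_finite)
  have "scal u b b * scal u x b = r b" if b: "b \<in> B" for b
  proof -
    have "scal u x b = (\<Sum>c\<in>B. if c = b then r b * scal u b b else 0)"
      unfolding r scal.sum_left using B(3) b
      by (intro sum.cong) (auto simp: scal.scaleR_left)
    also have "\<dots> = r b * scal u b b"
      using b B(1) by simp
    finally show ?thesis
      using B(2)[OF b] by auto
  qed
  then show ?thesis
    unfolding r[symmetric] by (metis (no_types, lifting) r sum.cong)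
qed

lemma orthonormal_independent:
  assumes B: "finite B" "\<And>b. b \<in> B \<Longrightarrow> scal u b b = 1 \<or> scal u b b = - 1"
    "\<And>b c. b \<in> B \<Longrightarrow> c \<in> B \<Longrightarrow> b \<noteq> c \<Longrightarrow> scal u b c = 0"
  shows "independent B"
proof (rule independent_if_scalars_zero[OF B(1)])
  fix r b
  assume 0: "(\<Sum>c\<in>B. r c *\<^sub>R c) = 0" and b: "b \<in> B"
  have "0 = scal u (\<Sum>c\<in>B. r c *\<^sub>R c) b"
    by (simp add: 0 scal.zero_left)
  also have "\<dots> = (\<Sum>c\<in>B. if c = b then r b * scal u b b else 0)"
    unfolding scal.sum_left using B(3) b
    by (intro sum.cong) (auto simp: scal.scaleR_left)
  also have "\<dots> = r b * scal u b b"
    using b B(1) by simp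
  finally show "r b = 0"
    using B(2)[OF b] by auto
qed

text \<open>
  An orthonormal subset \<open>B\<close> of \<open>W\<close> of maximal size spans \<open>W\<close>: by maximality every vector of
  \<open>N = W \<inter> B\<^sup>\<bottom>\<close> is null, hence by polarisation \<open>N\<close> is orthogonal to itself. It is orthogonal to
  \<open>B\<close> too, so to all of \<open>W = span B + N\<close>, and \<open>N = 0\<close> by nondegeneracy.
\<close>

lemma orthonormal_basis_exists:
  fixes W :: "'m::{finite,linorder} ambient set"
  assumes W: "subspace W"
    and nd: "\<And>y. y \<in> W \<Longrightarrow> (\<And>w. w \<in> W \<Longrightarrow> scal u y w = 0) \<Longrightarrow> y = 0"
  obtains B where "orthonormal_basis u W B"
proof -
  define on where "on B \<longleftrightarrow> finite B \<and> B \<subseteq> W \<and>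
     (\<forall>b\<in>B. scal u b b = 1 \<or> scal u b b = - 1) \<and>
     (\<forall>b\<in>B. \<forall>c\<in>B. b \<noteq> c \<longrightarrow> scal u b c = 0)" for B
  have card: "card B \<le> CARD('m)" if "on B" for B
  proof -
    have "independent B"
      using that by (intro orthonormal_independent[of B u]) (auto simp: on_def)
    then show ?thesis
      using independent_bound[of B] by simp
  qed
  have "on {}" by (simp add: on_def)
  then obtain B where B: "on B" and mx: "\<And>C. on C \<Longrightarrow> card C \<le> card B"
    using ex_has_greatest_nat[of on "{}" card "Suc CARD('m)"] card by (auto simp: less_Suc_eq_le)
  define N where "N = {y\<in>W. \<forall>b\<in>B. scal u y b = 0}"
  have Nsub: "y + z \<in> N" if "y \<in> N" "z \<in> N" for y z
    using that W by (auto simp: N_def subspace_add scal.add_left)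
  have iso: "scal u y y = 0" if y: "y \<in> N" for y
  proof (rule ccontr)
    assume k: "scal u y y \<noteq> 0"
    define e where "e = (1 / sqrt \<bar>scal u y y\<bar>) *\<^sub>R y"
    have ee: "scal u e e = scal u y y / \<bar>scal u y y\<bar>"
      by (simp add: e_def scal.scaleR_left scal.scaleR_right flip: real_sqrt_mult)
    then have "scal u e e = 1 \<or> scal u e e = - 1"
      using k by (auto simp: abs_if)
    moreover have "e \<in> W" "\<And>b. b \<in> B \<Longrightarrow> scal u e b = 0"
      using y W by (auto simp: e_def N_def subspace_scale scal.scaleR_left)
    moreover from this have "\<And>b. b \<in> B \<Longrightarrow> scal u b e = 0"
      by (simp add: scal_commute)
    ultimately have "on (insert e B)" "e \<notin> B"
      using B by (auto simp: on_def)
    then show False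
      using mx[of "insert e B"] B by (auto simp: on_def)
  qed
  have iso2: "scal u y z = 0" if "y \<in> N" "z \<in> N" for y z
    using iso[OF Nsub[OF that]] iso[OF that(1)] iso[OF that(2)] scal_commute[of u y z]
    by (simp add: scal.add_left scal.add_right)
  define pr where "pr y = (\<Sum>b\<in>B. (scal u b b * scal u y b) *\<^sub>R b)" for y
  have prspan: "pr y \<in> span B" for y
    unfolding pr_def by (intro span_sum span_scale span_base)
  have BW: "span B \<subseteq> W"
    using B W by (auto simp: on_def intro: span_minimal[THEN subsetD])
  have rest: "y - pr y \<in> N" if y: "y \<in> W" for y
  proof -
    have "scal u (y - pr y) b = 0" if b: "b \<in> B" for b
    proof -
      have "scal u (pr y) b = (\<Sum>c\<in>B. if c = b then (scal u b b * scal u y b) * scal u b b else 0)"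
        unfolding pr_def scal.sum_left using B b
        by (intro sum.cong) (auto simp: scal.scaleR_left on_def)
      also have "\<dots> = scal u y b"
        using B b by (auto simp: on_def)
      finally show ?thesis
        by (simp add: scal.diff_left)
    qed
    moreover have "y - pr y \<in> W"
      using y BW prspan W by (auto intro: subspace_diff)
    ultimately show ?thesis
      by (simp add: N_def)
  qed
  have N0: "y = 0" if y: "y \<in> N" for y
  proof (rule nd)
    show "y \<in> W" using y by (simp add: N_def)
    fix w assume w: "w \<in> W"
    have "scal u y (pr w) = 0"
      unfolding pr_def scal.sum_right using y
      by (intro sum.neutral) (auto simp: scal.scaleR_right N_def)
    with iso2[OF y rest[OF w]] show "scal u y w = 0"
      by (simp add: scal.diff_right)
  qed
  have "W \<subseteq> span B"
  proof
    fix y assume "y \<in> W"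
    from N0[OF rest[OF this]] prspan[of y] show "y \<in> span B"
      by simp
  qed
  with B BW have "orthonormal_basis u W B"
    by (auto simp: on_def orthonormal_basis_def)
  then show thesis
    by (rule that)
qed

lemma orthonormal_basis_expansion:
  assumes "orthonormal_basis u W B" "x \<in> W"
  shows "x = (\<Sum>b\<in>B. (scal u b b * scal u x b) *\<^sub>R b)"
  using assms by (intro orthonormal_expansion) (auto simp: orthonormal_basis_def)

lemma sum_orthonormal_scal:
  assumes "orthonormal_basis u W B" "x \<in> W"
  shows "(\<Sum>b\<in>B. scal u b b * (scal u b x * scal u b y)) = scal u x y"
proof -
  have "scal u x y = (\<Sum>b\<in>B. scal u b b * scal u x b * scal u b y)"
    by (subst orthonormal_basis_expansion[OF assms]) (simp add: scal.sum_left scal.scaleR_left)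
  also have "\<dots> = (\<Sum>b\<in>B. scal u b b * (scal u b x * scal u b y))"
    by (intro sum.cong refl) (simp add: scal_commute[of u x])
  finally show ?thesis
    by simp
qed

text \<open>
  Expanding the vectors of \<open>B\<close> in \<open>C\<close> turns the left-hand side into a double sum over \<open>C\<close> whose
  coefficients are again scalar products of vectors of \<open>C\<close>, by \<open>sum_orthonormal_scal\<close> for \<open>B\<close>.
\<close>

lemma orthonormal_sum_independent:
  assumes B: "orthonormal_basis u W B" and C: "orthonormal_basis u W C"
    and T: "\<And>z. linear (\<lambda>w. T w z)" "\<And>w. linear (T w)"
  shows "(\<Sum>b\<in>B. scal u b b *\<^sub>R T b b) = (\<Sum>c\<in>C. scal u c c *\<^sub>R T c c)"
proof -
  have exp: "T b b = (\<Sum>c\<in>C. \<Sum>d\<in>C.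
      (scal u c c * scal u b c * (scal u d d * scal u b d)) *\<^sub>R T c d)" if b: "b \<in> B" for b
  proof -
    have bW: "b \<in> W"
      using B b by (auto simp: orthonormal_basis_def)
    define s where "s c = scal u c c * scal u b c" for c
    have eq: "b = (\<Sum>c\<in>C. s c *\<^sub>R c)"
      unfolding s_def by (rule orthonormal_basis_expansion[OF C bW])
    have "T b b = T (\<Sum>c\<in>C. s c *\<^sub>R c) (\<Sum>d\<in>C. s d *\<^sub>R d)"
      using eq by simp
    also have "\<dots> = (\<Sum>c\<in>C. s c *\<^sub>R T c (\<Sum>d\<in>C. s d *\<^sub>R d))"
      by (simp add: linear_sum[OF T(1)] linear_scale[OF T(1)])
    also have "\<dots> = (\<Sum>c\<in>C. \<Sum>d\<in>C. (s c * s d) *\<^sub>R T c d)"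
      by (simp add: linear_sum[OF T(2)] linear_scale[OF T(2)] scaleR_sum_right)
    finally show ?thesis
      by (simp add: s_def)
  qed
  have "(\<Sum>b\<in>B. scal u b b *\<^sub>R T b b) = (\<Sum>b\<in>B. \<Sum>c\<in>C. \<Sum>d\<in>C.
      (scal u b b * (scal u c c * scal u b c * (scal u d d * scal u b d))) *\<^sub>R T c d)"
    by (intro sum.cong refl) (simp add: exp scaleR_sum_right)
  also have "\<dots> = (\<Sum>c\<in>C. \<Sum>d\<in>C. \<Sum>b\<in>B.
      (scal u b b * (scal u c c * scal u b c * (scal u d d * scal u b d))) *\<^sub>R T c d)"
    by (rule trans[OF sum.swap], rule sum.cong[OF refl], rule sum.swap)
  also have "\<dots> = (\<Sum>c\<in>C. \<Sum>d\<in>C. if d = c then scal u c c *\<^sub>R T c c else 0)"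
  proof (intro sum.cong refl)
    fix c d assume c: "c \<in> C" and d: "d \<in> C"
    then have cW: "c \<in> W" using C by (auto simp: orthonormal_basis_def)
    have "(\<Sum>b\<in>B. (scal u b b * (scal u c c * scal u b c * (scal u d d * scal u b d))) *\<^sub>R T c d)
      = (scal u c c * scal u d d * (\<Sum>b\<in>B. scal u b b * (scal u b c * scal u b d))) *\<^sub>R T c d"
      unfolding scaleR_sum_left[symmetric] sum_distrib_left
      by (intro arg_cong2[where f = "(*\<^sub>R)"] sum.cong refl) simp
    also have "\<dots> = (scal u c c * scal u d d * scal u c d) *\<^sub>R T c d"
      by (simp add: sum_orthonormal_scal[OF B cW])
    also have "\<dots> = (if d = c then scal u c c *\<^sub>R T c c else 0)"
      using C c d by (auto simp: orthonormal_basis_def)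
    finally show "(\<Sum>b\<in>B. (scal u b b * (scal u c c * scal u b c * (scal u d d * scal u b d))) *\<^sub>R T c d)
      = (if d = c then scal u c c *\<^sub>R T c c else 0)" .
  qed
  also have "\<dots> = (\<Sum>c\<in>C. scal u c c *\<^sub>R T c c)"
    using C by (intro sum.cong) (auto simp: orthonormal_basis_def)
  finally show ?thesis .
qed

text \<open>
  The forms that occur on a tangent space have a meaning on tangent vectors only; there they agree with
  a form \<open>T\<close> that is bilinear on the whole ambient space.
\<close>

lemma metric_trace_eq_sum:
  assumes B: "orthonormal_basis u W B"
    and T: "\<And>z. linear (\<lambda>w. T w z)" "\<And>w. linear (T w)"
    and eq: "\<And>w z. w \<in> W \<Longrightarrow> z \<in> W \<Longrightarrow> T' w z = T w z"
  shows "metric_trace u W T' = (\<Sum>b\<in>B. scal u b b *\<^sub>R T b b)"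
proof -
  have *: "(\<Sum>b\<in>C. scal u b b *\<^sub>R T' b b) = (\<Sum>b\<in>B. scal u b b *\<^sub>R T b b)"
    if C: "orthonormal_basis u W C" for C
  proof -
    have "(\<Sum>b\<in>C. scal u b b *\<^sub>R T' b b) = (\<Sum>b\<in>C. scal u b b *\<^sub>R T b b)"
      using C by (intro sum.cong) (auto simp: orthonormal_basis_def eq subset_iff)
    also have "\<dots> = (\<Sum>b\<in>B. scal u b b *\<^sub>R T b b)"
      by (rule orthonormal_sum_independent[OF C B T])
    finally show ?thesis .
  qed
  show ?thesis
    unfolding metric_trace_def
    by (rule the_equality) (use * B in auto)
qed


section \<open>Smooth functions\<close>

lemma Ck_on_cong:
  assumes "open U" "\<And>x. x \<in> U \<Longrightarrow> f x = g x" "Ck_on k f U"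
  shows "Ck_on k g U"
  using assms(2,3)
proof (induction k arbitrary: f g)
  case 0
  then show ?case
    using continuous_on_cong[of U U f g] by simp
next
  case (Suc k)
  have d: "(g has_derivative frechet_derivative f (at x)) (at x)" if x: "x \<in> U" for x
    using Suc.prems x assms(1)
    by (intro has_derivative_transform_within_open[of f _ x UNIV U g])
      (auto simp: frechet_derivative_works)
  show ?case
    unfolding Ck_on.simps
  proof (intro conjI ballI allI)
    show "g differentiable (at x)" if "x \<in> U" for x
      using d[OF that] by (rule differentiableI)
    show "Ck_on k (\<lambda>x. frechet_derivative g (at x) w) U" for w
    proof (rule Suc.IH)
      show "Ck_on k (\<lambda>x. frechet_derivative f (at x) w) U"
        using Suc.prems by simp
      show "frechet_derivative f (at x) w = frechet_derivative g (at x) w" if "x \<in> U" for x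
        using frechet_derivative_at[OF d[OF that]] by simp
    qed
  qed
qed

lemma Ck_on_subset: "Ck_on k f U \<Longrightarrow> V \<subseteq> U \<Longrightarrow> Ck_on k f V"
  by (induction k arbitrary: f) (auto intro: continuous_on_subset)

lemma Ck_on_Suc_imp: "Ck_on (Suc k) f U \<Longrightarrow> Ck_on k f U"
proof (induction k arbitrary: f)
  case 0
  then show ?case
    by (auto intro!: continuous_at_imp_continuous_on differentiable_imp_continuous_within)
next
  case (Suc k)
  then show ?case
    by (metis Ck_on.simps(2))
qed

text \<open>
  This makes the usual differentiation rules available for the recursive definition of \<open>C\<^sup>k\<close>: on an
  open set a formula \<open>f'\<close> for the derivative may replace the chosen Frechet derivative.
\<close>

lemma Ck_on_SucI:
  assumes "open U" "\<And>x. x \<in> U \<Longrightarrow> (f has_derivative f' x) (at x)"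
    "\<And>w. Ck_on k (\<lambda>x. f' x w) U"
  shows "Ck_on (Suc k) f U"
  unfolding Ck_on.simps
proof (intro conjI ballI allI)
  show "f differentiable (at x)" if "x \<in> U" for x
    using assms(2)[OF that] by (rule differentiableI)
  show "Ck_on k (\<lambda>x. frechet_derivative f (at x) w) U" for w
    using assms(1) _ assms(3)[of w]
    by (rule Ck_on_cong) (metis assms(2) frechet_derivative_at)
qed

lemma Ck_on_const: "open U \<Longrightarrow> Ck_on k (\<lambda>x. c) U"
proof (induction k arbitrary: c)
  case 0
  then show ?case by simp
next
  case (Suc k)
  then show ?case
    by (intro Ck_on_SucI[where f' = "\<lambda>x w. 0"]) auto
qed

lemma Ck_on_bounded_linear:
  assumes "open U" "bounded_linear f"
  shows "Ck_on k f U"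
proof (cases k)
  case 0
  then show ?thesis
    using assms by (simp add: linear_continuous_on)
next
  case (Suc l)
  have "Ck_on (Suc l) f U"
    using assms by (intro Ck_on_SucI[where f' = "\<lambda>x w. f w"])
      (auto intro: bounded_linear_imp_has_derivative Ck_on_const)
  then show ?thesis
    using Suc by simp
qed

lemma Ck_on_add:
  assumes "open U"
  shows "Ck_on k f U \<Longrightarrow> Ck_on k g U \<Longrightarrow> Ck_on k (\<lambda>x. f x + g x) U"
proof (induction k arbitrary: f g)
  case 0
  then show ?case by (simp add: continuous_on_add)
next
  case (Suc k)
  show ?case
  proof (rule Ck_on_SucI[OF assms])
    show "((\<lambda>x. f x + g x) has_derivative
        (\<lambda>w. frechet_derivative f (at x) w + frechet_derivative g (at x) w)) (at x)" if "x \<in> U" for x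
      using that Suc.prems by (intro has_derivative_add) (auto simp: frechet_derivative_works)
  qed (use Suc in auto)
qed

lemma Ck_on_bilinear:
  assumes U: "open U" and h: "bounded_bilinear h"
  shows "Ck_on k f U \<Longrightarrow> Ck_on k g U \<Longrightarrow> Ck_on k (\<lambda>x. h (f x) (g x)) U"
proof (induction k arbitrary: f g)
  case 0
  then show ?case
    using bounded_bilinear.continuous_on[OF h] by simp
next
  case (Suc k)
  show ?case
  proof (rule Ck_on_SucI[OF U])
    show "((\<lambda>x. h (f x) (g x)) has_derivative
        (\<lambda>w. h (f x) (frechet_derivative g (at x) w) + h (frechet_derivative f (at x) w) (g x))) (at x)"
      if "x \<in> U" for x
      using that Suc.prems
      by (intro bounded_bilinear.FDERIV[OF h]) (auto simp: frechet_derivative_works)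
    show "Ck_on k (\<lambda>x. h (f x) (frechet_derivative g (at x) w) +
        h (frechet_derivative f (at x) w) (g x)) U" for w
      using Suc.prems Ck_on_Suc_imp
      by (intro Ck_on_add[OF U] Suc.IH) (auto simp del: Ck_on.simps(1) intro: Ck_on_Suc_imp)
  qed
qed

lemma smooth_fun_global:
  assumes "\<And>k. Ck_on k f UNIV"
  shows "smooth_fun M f"
  unfolding smooth_fun_def local_ext_def Cinf_on_def
proof
  fix x
  show "\<exists>U g. open U \<and> x \<in> U \<and> (\<forall>k. Ck_on k g U) \<and> (\<forall>y\<in>U \<inter> M. g y = f y)"
    using assms by (intro exI[of _ UNIV] exI[of _ f]) auto
qed

lemma smooth_fun_const: "smooth_fun M (\<lambda>x. c)"
  by (rule smooth_fun_global) (simp add: Ck_on_const)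

lemma smooth_fun_bounded_linear: "bounded_linear f \<Longrightarrow> smooth_fun M f"
  by (rule smooth_fun_global) (simp add: Ck_on_bounded_linear)

lemma smooth_fun_cong:
  "(\<And>x. x \<in> M \<Longrightarrow> f x = g x) \<Longrightarrow> smooth_fun M f \<longleftrightarrow> smooth_fun M g"
  unfolding smooth_fun_def local_ext_def by (simp cong: conj_cong)

lemma smooth_fun_combine:
  fixes M :: "'a::real_normed_vector set"
  assumes f: "smooth_fun M f" and g: "smooth_fun M g"
    and h: "\<And>k (U :: 'a set) f g. open U \<Longrightarrow> Ck_on k f U \<Longrightarrow> Ck_on k g U \<Longrightarrow> Ck_on k (\<lambda>x. h (f x) (g x)) U"
  shows "smooth_fun M (\<lambda>x. h (f x) (g x))"
  unfolding smooth_fun_def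
proof
  fix x assume x: "x \<in> M"
  obtain U f' where U: "local_ext M f x U f'"
    using f x by (auto simp: smooth_fun_def)
  obtain V g' where V: "local_ext M g x V g'"
    using g x by (auto simp: smooth_fun_def)
  have "local_ext M (\<lambda>x. h (f x) (g x)) x (U \<inter> V) (\<lambda>x. h (f' x) (g' x))"
    unfolding local_ext_def Cinf_on_def
  proof (intro conjI allI)
    show "Ck_on k (\<lambda>x. h (f' x) (g' x)) (U \<inter> V)" for k
      by (rule h) (use U V in \<open>auto simp: local_ext_def Cinf_on_def
          intro: Ck_on_subset[of _ _ U] Ck_on_subset[of _ _ V]\<close>)
  qed (use U V in \<open>auto simp: local_ext_def\<close>)
  then show "\<exists>U k. local_ext M (\<lambda>x. h (f x) (g x)) x U k"
    by blast
qed

lemma smooth_fun_add: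
  "smooth_fun M f \<Longrightarrow> smooth_fun M g \<Longrightarrow> smooth_fun M (\<lambda>x. f x + g x)"
  by (rule smooth_fun_combine[where h = "(+)"]) (auto intro: Ck_on_add)

lemma smooth_fun_bilinear:
  "bounded_bilinear h \<Longrightarrow> smooth_fun M f \<Longrightarrow> smooth_fun M g \<Longrightarrow> smooth_fun M (\<lambda>x. h (f x) (g x))"
  by (rule smooth_fun_combine[where h = h]) (auto intro: Ck_on_bilinear)

text \<open>
  Functions on \<open>M\<close> are differentiated with the filter \<open>at x within M\<close>: derivatives of local
  extensions are derivatives within \<open>M\<close>, and no extension has to be named in calculations. Such
  derivatives are unique on tangent vectors only, which is \<open>has_derivative_unique_tangent\<close> below.
\<close>

lemma local_ext_has_derivative:
  assumes e: "local_ext M f x U g" and x: "x \<in> M"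
  shows "(f has_derivative frechet_derivative g (at x)) (at x within M)"
proof -
  have U: "open U" "x \<in> U" and eq: "\<And>y. y \<in> U \<Longrightarrow> y \<in> M \<Longrightarrow> g y = f y"
    using e by (auto simp: local_ext_def)
  have "Ck_on 1 g U"
    using e by (simp add: local_ext_def Cinf_on_def)
  then have "(g has_derivative frechet_derivative g (at x)) (at x)"
    using U by (simp add: frechet_derivative_works)
  then have "(g has_derivative frechet_derivative g (at x)) (at x within M)"
    by (rule has_derivative_at_withinI)
  moreover have "eventually (\<lambda>y. g y = f y) (at x within M)"
    unfolding eventually_at_topological using U eq by blast
  ultimately show ?thesis
    by (rule has_derivative_transform_eventually) (use U x eq in auto)
qed

lemma has_derivative_transform_on:
  assumes "(f has_derivative f') (at x within S)" "x \<in> S" "\<And>y. y \<in> S \<Longrightarrow> g y = f y"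
  shows "(g has_derivative f') (at x within S)"
  using assms(2,3,1) by (rule has_derivative_transform)

lemma smooth_fun_has_derivative:
  assumes "smooth_fun M f" "x \<in> M"
  shows "(f has_derivative frechet_derivative f (at x within M)) (at x within M)"
  using assms local_ext_has_derivative unfolding smooth_fun_def
  by (metis differentiableI frechet_derivative_works)


section \<open>Calculus on a hyperquadric\<close>

text \<open>
  The value \<open>\<langle>x, x\<rangle> = \<epsilon>\<close> is also the curvature, so pseudo-spheres and pseudo-hyperbolic spaces need
  no separate treatment.
\<close>

locale hyperquadric =
  fixes u :: nat and \<epsilon> :: real and M :: "'m::{finite,linorder} ambient set"
  assumes curvature: "\<epsilon> = 1 \<or> \<epsilon> = - 1"
    and M_def: "M = {x. scal u x x = \<epsilon>}"
begin

lemma eps_square [simp]: "\<epsilon> * \<epsilon> = 1" "\<epsilon> * (\<epsilon> * a) = a"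
  using curvature by auto

lemma scal_position: "x \<in> M \<Longrightarrow> scal u x x = \<epsilon>"
  by (simp add: M_def)

lemma tangentD: "w \<in> tangent u x \<Longrightarrow> scal u x w = 0" "w \<in> tangent u x \<Longrightarrow> scal u w x = 0"
  by (simp_all add: tangent_def scal_commute[of u w x])

lemma tangential_part: "x \<in> M \<Longrightarrow> w - (\<epsilon> * scal u x w) *\<^sub>R x \<in> tangent u x"
  by (simp add: tangent_def scal.diff_right scal.scaleR_right scal_position algebra_simps)

lemma tangent_nondegenerate:
  assumes x: "x \<in> M" and y: "y \<in> tangent u x"
    and 0: "\<And>w. w \<in> tangent u x \<Longrightarrow> scal u y w = 0"
  shows "y = 0"
proof (rule scal_nondegenerate)
  fix w
  show "scal u y w = 0"
    using 0[OF tangential_part[OF x, of w]] tangentD(2)[OF y]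
    by (simp add: scal.diff_right scal.scaleR_right)
qed

lemma tangent_basis_exists:
  assumes x: "x \<in> M"
  obtains B where "orthonormal_basis u (tangent u x) B"
  using orthonormal_basis_exists[OF subspace_tangent] tangent_nondegenerate[OF x] by metis

text \<open>
  The position vector \<open>x\<close> is itself the unit normal at \<open>x\<close>. This is what relates traces along \<open>M\<close> to
  traces in the ambient space, in particular to \<open>\<langle>A, A\<rangle>\<close>.
\<close>

lemma orthonormal_basis_insert_position:
  assumes x: "x \<in> M" and B: "orthonormal_basis u (tangent u x) B"
  shows "orthonormal_basis u UNIV (insert x B)" and "x \<notin> B"
proof -
  have BT: "B \<subseteq> tangent u x" "span B = tangent u x"
    using B by (auto simp: orthonormal_basis_def)
  show "x \<notin> B"
    using BT x curvature by (auto simp: tangent_def scal_position)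
  have "w \<in> span (insert x B)" for w
  proof -
    have "w - (\<epsilon> * scal u x w) *\<^sub>R x \<in> span B"
      using tangential_part[OF x] BT by simp
    then show ?thesis
      unfolding span_insert by blast
  qed
  moreover have "scal u x b = 0" "scal u b x = 0" if "b \<in> B" for b
    using BT that tangentD by blast+
  ultimately show "orthonormal_basis u UNIV (insert x B)"
    using B x curvature unfolding orthonormal_basis_def
    by (auto simp: scal_position)
qed

lemma metric_trace_UNIV:
  assumes x: "x \<in> M" and B: "orthonormal_basis u (tangent u x) B"
    and T: "\<And>z. linear (\<lambda>w. T w z)" "\<And>w. linear (T w)"
  shows "metric_trace u UNIV T = \<epsilon> *\<^sub>R T x x + (\<Sum>b\<in>B. scal u b b *\<^sub>R T b b)"
proof -
  note ins = orthonormal_basis_insert_position[OF x B]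
  have "metric_trace u UNIV T = (\<Sum>b\<in>insert x B. scal u b b *\<^sub>R T b b)"
    by (rule metric_trace_eq_sum[OF ins(1) T refl])
  then show ?thesis
    using B ins(2) x by (simp add: orthonormal_basis_def scal_position)
qed

lemma card_tangent_basis:
  fixes B :: "'m ambient set"
  assumes x: "x \<in> M" and B: "orthonormal_basis u (tangent u x) B"
  shows "CARD('m) = card B + 1"
proof -
  note ins = orthonormal_basis_insert_position[OF x B]
  have "independent (insert x B)"
    using ins(1) by (intro orthonormal_independent[of _ u]) (auto simp: orthonormal_basis_def)
  then have "card (insert x B) = dim (UNIV :: 'm ambient set)"
    using ins(1) by (intro basis_card_eq_dim) (auto simp: orthonormal_basis_def)
  then show ?thesis
    using ins(2) B by (simp add: orthonormal_basis_def)
qed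

text \<open>
  The line \<open>x + tw\<close>, rescaled to the quadric. Since \<open>\<langle>x, w\<rangle> = 0\<close>, the scalar square along the line is
  \<open>\<epsilon>(1 + kt\<^sup>2)\<close> with \<open>k = \<epsilon>\<langle>w, w\<rangle>\<close>, so the scaling factor has derivative \<open>0\<close> at \<open>t = 0\<close> and the
  curve has velocity \<open>w\<close> there. The curve stays on multiples of the line, which decides where a linear
  map vanishes along it.
\<close>

lemma tangent_curve:
  assumes x: "x \<in> M" and w: "w \<in> tangent u x"
  obtains c S where "open S" "(0::real) \<in> S" "\<And>t. t \<in> S \<Longrightarrow> c t \<in> M" "c 0 = x"
    "\<And>t. t \<in> S \<Longrightarrow> \<exists>s. s \<noteq> 0 \<and> c t = s *\<^sub>R (x + t *\<^sub>R w)"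
    "(c has_derivative (\<lambda>t. t *\<^sub>R w)) (at 0)"
proof
  define k where "k = \<epsilon> * scal u w w"
  define S where "S = {t::real. 0 < 1 + k * t\<^sup>2}"
  define c where "c t = (1 / sqrt (1 + k * t\<^sup>2)) *\<^sub>R (x + t *\<^sub>R w)" for t
  show "open S"
    unfolding S_def by (intro open_Collect_less continuous_intros)
  show "0 \<in> S" "c 0 = x"
    by (simp_all add: S_def c_def)
  show "c t \<in> M" if t: "t \<in> S" for t
  proof -
    have "scal u (x + t *\<^sub>R w) (x + t *\<^sub>R w) = \<epsilon> * (1 + k * t\<^sup>2)"
      using tangentD[OF w] x
      by (simp add: scal.add_left scal.add_right scal.scaleR_left scal.scaleR_right
          scal_position k_def algebra_simps power2_eq_square)
    moreover have "1 + k * t\<^sup>2 > 0"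
      using t by (simp add: S_def)
    ultimately show ?thesis
      by (simp add: M_def c_def scal.scaleR_left scal.scaleR_right flip: power2_eq_square real_sqrt_mult)
  qed
  show "\<exists>s. s \<noteq> 0 \<and> c t = s *\<^sub>R (x + t *\<^sub>R w)" if "t \<in> S" for t
    using that by (intro exI[of _ "1 / sqrt (1 + k * t\<^sup>2)"]) (simp add: c_def S_def)
  have "((\<lambda>t. 1 / sqrt (1 + k * t\<^sup>2)) has_real_derivative 0) (at 0)"
    by (auto intro!: derivative_eq_intros)
  then have "((\<lambda>t. 1 / sqrt (1 + k * t\<^sup>2)) has_derivative (\<lambda>t. 0)) (at 0)"
    by (simp only: has_field_derivative_def lambda_zero)
  then show "(c has_derivative (\<lambda>t. t *\<^sub>R w)) (at 0)"
    unfolding c_def by (auto intro!: derivative_eq_intros)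
qed

text \<open>
  Composed with the curve of \<open>tangent_curve\<close>, both derivatives become derivatives of one function on
  an open set of reals.
\<close>

lemma has_derivative_unique_tangent:
  assumes f: "(f has_derivative f1) (at x within M)" "(f has_derivative f2) (at x within M)"
    and x: "x \<in> M" and w: "w \<in> tangent u x"
  shows "f1 w = f2 w"
proof -
  obtain c S where c: "open S" "(0::real) \<in> S" "\<And>t. t \<in> S \<Longrightarrow> c t \<in> M" "c 0 = x"
    "(c has_derivative (\<lambda>t. t *\<^sub>R w)) (at 0)"
    using tangent_curve[OF x w] by metis
  have "(f \<circ> c has_derivative f' \<circ> (\<lambda>t. t *\<^sub>R w)) (at 0)"
    if "(f has_derivative f') (at x within M)" for f'
  proof -
    have "(f has_derivative f') (at (c 0) within c ` S)"
      using that c by (auto intro: has_derivative_subset)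
    then have "(f \<circ> c has_derivative f' \<circ> (\<lambda>t. t *\<^sub>R w)) (at 0 within S)"
      using c by (intro diff_chain_within) (auto intro: has_derivative_at_withinI)
    then show ?thesis
      by (simp only: at_within_open[OF c(2,1)])
  qed
  from fun_cong[OF has_derivative_unique[OF this[OF f(1)] this[OF f(2)]], of 1]
  show ?thesis
    by simp
qed

lemma tderiv_eq:
  assumes f: "smooth_fun M f" and f': "(f has_derivative f') (at x within M)"
    and x: "x \<in> M" and w: "w \<in> tangent u x"
  shows "tderiv M f x w = f' w"
  unfolding tderiv_def
proof (rule the_equality)
  have *: "frechet_derivative g (at x) w = f' w" if "local_ext M f x U g" for U g
    using has_derivative_unique_tangent[OF local_ext_has_derivative[OF that x] f' x w] .
  then show "d = f' w" if "\<exists>U g. local_ext M f x U g \<and> d = frechet_derivative g (at x) w" for d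
    using that by blast
  show "\<exists>U g. local_ext M f x U g \<and> f' w = frechet_derivative g (at x) w"
    using f x * unfolding smooth_fun_def by metis
qed

lemma vector_fieldD:
  assumes "vector_field u M Y"
  shows "smooth_fun M Y" "\<And>x. x \<in> M \<Longrightarrow> Y x \<in> tangent u x"
  using assms by (auto simp: vector_field_def)

text \<open>
  Differentiate \<open>\<langle>y, Y(y)\<rangle> = 0\<close> along \<open>M\<close>.
\<close>

lemma vector_field_derivative_normal:
  assumes Y: "vector_field u M Y" and Y': "(Y has_derivative Y') (at x within M)"
    and x: "x \<in> M" and w: "w \<in> tangent u x"
  shows "scal u x (Y' w) = - scal u w (Y x)"
proof -
  have "((\<lambda>y. scal u y (Y y)) has_derivative (\<lambda>w. scal u x (Y' w) + scal u w (Y x))) (at x within M)"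
    by (intro scal.FDERIV has_derivative_ident Y')
  moreover have "((\<lambda>y. scal u y (Y y)) has_derivative (\<lambda>w. 0)) (at x within M)"
    using vector_fieldD(2)[OF Y] x
    by (intro has_derivative_transform_on[OF has_derivative_const x]) (simp add: tangentD)
  ultimately have "scal u x (Y' w) + scal u w (Y x) = 0"
    by (rule has_derivative_unique_tangent[OF _ _ x w])
  then show ?thesis
    by simp
qed

lemma tangential_part_field:
  "vector_field u M (\<lambda>y. w - (\<epsilon> * scal u y w) *\<^sub>R y)"
proof -
  have "smooth_fun M (\<lambda>y. w + (- (\<epsilon> * scal u y w)) *\<^sub>R y)"
    by (rule smooth_fun_add[OF smooth_fun_const smooth_fun_bilinear[OF bounded_bilinear_scaleR
        smooth_fun_bounded_linear[OF bounded_linear_minus[OF bounded_linear_const_mult[OF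
          scal.bounded_linear_left]]] smooth_fun_bounded_linear[OF bounded_linear_ident]]])
  then show ?thesis
    by (simp add: vector_field_def tangential_part)
qed

text \<open>
  The axioms of a connection speak of vector fields; a global field through a given tangent vector
  allows their use at single vectors.
\<close>

lemma tangent_extension:
  assumes x: "x \<in> M" and w: "w \<in> tangent u x"
  obtains X where "vector_field u M X" "X x = w"
  using tangential_part_field[of w] tangentD(1)[OF w]
  by (metis (no_types, lifting) diff_zero mult_zero_right scaleR_zero_left)

text \<open>
  The derivations defining a bracket are tested on the linear functions \<open>\<langle>e, -\<rangle>\<close>, for which
  \<open>Y f = \<langle>e, Y\<rangle>\<close>; these determine the bracket by nondegeneracy.
\<close>

lemma lie_bracket_eq:
  assumes X: "vector_field u M X" and Y: "vector_field u M Y"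
    and Z: "is_lie_bracket u M X Y Z"
    and X': "(X has_derivative X') (at x within M)"
    and Y': "(Y has_derivative Y') (at x within M)"
    and x: "x \<in> M"
  shows "Z x = Y' (X x) - X' (Y x)"
proof -
  have td: "tderiv M (scal u e) y w = scal u e w" if "y \<in> M" "w \<in> tangent u y" for e y w
    using that scal.bounded_linear_right
    by (intro tderiv_eq smooth_fun_bounded_linear bounded_linear_imp_has_derivative)
  have field: "tderiv M (\<lambda>y. tderiv M (scal u e) y (V y)) x w = scal u e (V' w)"
    if V: "vector_field u M V" and V': "(V has_derivative V') (at x within M)"
      and w: "w \<in> tangent u x" for e V V' w
  proof (rule tderiv_eq[OF _ _ x w])
    have eq: "tderiv M (scal u e) y (V y) = scal u e (V y)" if "y \<in> M" for y
      using that V by (intro td vector_fieldD)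
    have "smooth_fun M (\<lambda>y. scal u e (V y))"
      using V by (intro smooth_fun_bilinear[OF bounded_bilinear_scal] smooth_fun_const vector_fieldD)
    then show "smooth_fun M (\<lambda>y. tderiv M (scal u e) y (V y))"
      by (subst smooth_fun_cong[of M _ "\<lambda>y. scal u e (V y)", OF eq])
    have "((\<lambda>y. scal u e (V y)) has_derivative (\<lambda>w. scal u e (V' w))) (at x within M)"
      using V' by (rule scal.bounded_linear_right[THEN bounded_linear.has_derivative])
    then show "((\<lambda>y. tderiv M (scal u e) y (V y)) has_derivative (\<lambda>w. scal u e (V' w))) (at x within M)"
      by (rule has_derivative_transform_on[OF _ x eq])
  qed
  have "scal u (Z x - (Y' (X x) - X' (Y x))) e = 0" for e
  proof -
    have "smooth_fun M (scal u e)"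
      by (intro smooth_fun_bounded_linear scal.bounded_linear_right)
    then have "tderiv M (scal u e) x (Z x) =
        tderiv M (\<lambda>y. tderiv M (scal u e) y (Y y)) x (X x) -
        tderiv M (\<lambda>y. tderiv M (scal u e) y (X y)) x (Y x)"
      and "Z x \<in> tangent u x"
      using Z x by (auto simp: is_lie_bracket_def vector_field_def)
    then have "scal u e (Z x) = scal u e (Y' (X x)) - scal u e (X' (Y x))"
      using X Y X' Y' x by (simp add: td field vector_fieldD)
    then show ?thesis
      by (simp add: scal_commute[of u _ e] scal.diff_right)
  qed
  then have "Z x - (Y' (X x) - X' (Y x)) = 0"
    by (rule scal_nondegenerate)
  then show ?thesis
    by simp
qed

lemma levi_civita_tangent:
  assumes D: "levi_civita u M D" and Y: "vector_field u M Y"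
    and x: "x \<in> M" and w: "w \<in> tangent u x"
  shows "D Y x w \<in> tangent u x"
proof -
  obtain X where X: "vector_field u M X" "X x = w"
    using tangent_extension[OF x w] .
  have "vector_field u M (\<lambda>x. D Y x (X x))"
    using D X Y by (simp add: levi_civita_def)
  from vector_fieldD(2)[OF this x] X show ?thesis
    by simp
qed

text \<open>
  Let \<open>S(Y, w)\<close> be the difference of the two sides. The right-hand side is also metric and torsion
  free, so \<open>\<langle>S(Y, X), Z\<rangle>\<close> is symmetric in \<open>X, Y\<close> and skew in \<open>Y, Z\<close>; a trilinear expression with
  these symmetries vanishes. As \<open>S(Y, w)\<close> is tangent, it is \<open>0\<close>.
\<close>

lemma levi_civita_eq:
  assumes D: "levi_civita u M D" and Y: "vector_field u M Y"
    and Y': "(Y has_derivative Y') (at x within M)"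
    and x: "x \<in> M" and w: "w \<in> tangent u x"
  shows "D Y x w = Y' w + (\<epsilon> * scal u (Y x) w) *\<^sub>R x"
proof -
  (* Within M only the values on tangent vectors matter, so any choice of derivative will do. *)
  define d where "d V = frechet_derivative V (at x within M)" for V :: "'m ambient \<Rightarrow> 'm ambient"
  define S where "S V w = D V x w - (d V w + (\<epsilon> * scal u (V x) w) *\<^sub>R x)" for V w
  have d: "(V has_derivative d V) (at x within M)" if "vector_field u M V" for V
    using smooth_fun_has_derivative[OF vector_fieldD(1)[OF that] x] by (simp add: d_def)
  have S_tangent: "S V w \<in> tangent u x" if V: "vector_field u M V" and w: "w \<in> tangent u x" for V w
    using levi_civita_tangent[OF D V x w] vector_field_derivative_normal[OF V d[OF V] x w] x
    by (simp add: S_def tangent_def scal.diff_right scal.add_right scal.scaleR_right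
        scal_position scal_commute[of u w])
  have S_sym: "S V (W x) = S W (V x)" if V: "vector_field u M V" and W: "vector_field u M W" for V W
  proof -
    have "is_lie_bracket u M W V (\<lambda>x. D V x (W x) - D W x (V x))"
      using D V W by (simp add: levi_civita_def)
    from lie_bracket_eq[OF W V this d[OF W] d[OF V] x] show ?thesis
      by (simp add: S_def scal_commute[of u "W x"] algebra_simps)
  qed
  have S_skew: "scal u (S V w) (Z x) = - scal u (S Z w) (V x)"
    if V: "vector_field u M V" and Z: "vector_field u M Z" and w: "w \<in> tangent u x" for V Z w
  proof -
    have "tderiv M (\<lambda>y. scal u (V y) (Z y)) x w = scal u (D V x w) (Z x) + scal u (V x) (D Z x w)"
      using D V Z x w by (simp add: levi_civita_def)
    moreover have "tderiv M (\<lambda>y. scal u (V y) (Z y)) x w = scal u (V x) (d Z w) + scal u (d V w) (Z x)"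
      using V Z by (intro tderiv_eq[OF _ _ x w] smooth_fun_bilinear[OF bounded_bilinear_scal]
          scal.FDERIV d vector_fieldD)
    ultimately show ?thesis
      using vector_fieldD(2)[OF V x] vector_fieldD(2)[OF Z x]
      by (simp add: S_def scal.diff_left scal.add_left scal.scaleR_left tangentD
          scal_commute[of u _ "V x"])
  qed
  (* Six alternating uses of the two symmetries return the expression with the opposite sign. *)
  have S0: "scal u (S V (W x)) (Z x) = 0"
    if V: "vector_field u M V" and W: "vector_field u M W" and Z: "vector_field u M Z" for V W Z
  proof -
    have t: "V x \<in> tangent u x" "W x \<in> tangent u x" "Z x \<in> tangent u x"
      using V W Z x by (auto intro: vector_fieldD)
    show ?thesis
      using S_sym[OF V W] S_sym[OF V Z] S_sym[OF W Z]
        S_skew[OF V Z t(2)] S_skew[OF V W t(3)] S_skew[OF W Z t(1)] by simp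
  qed
  have "S Y w = 0"
  proof (rule tangent_nondegenerate[OF x S_tangent[OF Y w]])
    fix z assume z: "z \<in> tangent u x"
    obtain W where W: "vector_field u M W" "W x = w"
      using tangent_extension[OF x w] .
    obtain Z where Z: "vector_field u M Z" "Z x = z"
      using tangent_extension[OF x z] .
    from S0[OF Y W(1) Z(1)] show "scal u (S Y w) z = 0"
      by (simp add: W Z)
  qed
  moreover have "d Y w = Y' w"
    by (rule has_derivative_unique_tangent[OF d[OF Y] Y' x w])
  ultimately show ?thesis
    by (simp add: S_def)
qed

end


section \<open>Killing fields\<close>

locale killing_extension = hyperquadric u \<epsilon> M
  for u :: nat and \<epsilon> :: real and M :: "'m::{finite,linorder} ambient set" +
  fixes D :: "'m connection" and \<sigma> A :: "'m ambient \<Rightarrow> 'm ambient"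
  assumes connection: "levi_civita u M D"
    and field: "vector_field u M \<sigma>"
    and extension: "linear_extension u M \<sigma> A"
begin

lemma linear_A: "linear A"
  and skew: "scal u (A x) y = - scal u x (A y)"
  and on_M: "x \<in> M \<Longrightarrow> \<sigma> x = A x"
  using extension by (simp_all add: linear_extension_def)

lemma A_has_derivative: "(f has_derivative f') F \<Longrightarrow> ((\<lambda>x. A (f x)) has_derivative (\<lambda>w. A (f' w))) F"
  using linear_A by (simp add: linear_conv_bounded_linear bounded_linear.has_derivative)

lemmas A_simps = linear_add[OF linear_A] linear_diff[OF linear_A] linear_neg[OF linear_A]
  linear_scale[OF linear_A]

lemmas scal_simps = scal.add_left scal.add_right scal.diff_left scal.diff_right
  scal.minus_left scal.minus_right scal.scaleR_left scal.scaleR_right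

lemma scal_A_same [simp]: "scal u (A x) x = 0" "scal u x (A x) = 0"
proof -
  show "scal u (A x) x = 0"
    using skew[of x x] scal_commute[of u x "A x"] by simp
  then show "scal u x (A x) = 0"
    by (simp add: scal_commute)
qed

lemma A_tangent: "A x \<in> tangent u x"
  by (simp add: tangent_def)

lemma covariant_derivative_killing:
  assumes x: "x \<in> M" and w: "w \<in> tangent u x"
  shows "D \<sigma> x w = A w + (\<epsilon> * scal u (A x) w) *\<^sub>R x"
proof -
  have "(\<sigma> has_derivative A) (at x within M)"
    by (rule has_derivative_transform_on[OF A_has_derivative[OF has_derivative_ident] x on_M])
  from levi_civita_eq[OF connection field this x w] show ?thesis
    using x by (simp add: on_M)
qed

text \<open>
  In the tangential derivative of \<open>\<nabla>\<^sub>Z\<sigma> = AZ + \<epsilon>\<langle>Ax, Z\<rangle>x\<close> the derivatives of \<open>Z\<close> cancel against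
  \<open>\<nabla>\<^bsub>\<nabla>\<^sub>wZ\<^esub>\<sigma>\<close>. What remains is the curvature operator of constant curvature \<open>\<epsilon>\<close>
  applied to \<open>\<sigma>\<close>, as in the general formula for the Hessian of a Killing field.
\<close>

lemma second_cov_killing:
  assumes x: "x \<in> M" and w: "w \<in> tangent u x" and z: "z \<in> tangent u x"
  shows "second_cov u M D \<sigma> x w z = (\<epsilon> * scal u (A x) z) *\<^sub>R w - (\<epsilon> * scal u z w) *\<^sub>R A x"
proof -
  have *: "D (\<lambda>y. D \<sigma> y (Z y)) x w - D \<sigma> x (D Z x w)
      = (\<epsilon> * scal u (A x) z) *\<^sub>R w - (\<epsilon> * scal u z w) *\<^sub>R A x"
    if Z: "vector_field u M Z" and Zx: "Z x = z" for Z
  proof -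
    define V where "V = (\<lambda>y. D \<sigma> y (Z y))"
    have V: "vector_field u M V"
      using connection field Z by (simp add: levi_civita_def V_def)
    have V_eq: "V y = A (Z y) + (\<epsilon> * scal u (A y) (Z y)) *\<^sub>R y" if "y \<in> M" for y
      unfolding V_def using that vector_fieldD(2)[OF Z]
      by (intro covariant_derivative_killing)
    obtain Z' where Z': "(Z has_derivative Z') (at x within M)"
      using smooth_fun_has_derivative[OF vector_fieldD(1)[OF Z] x] by blast
    have DZ: "D Z x w = Z' w + (\<epsilon> * scal u z w) *\<^sub>R x"
      using levi_civita_eq[OF connection Z Z' x w] Zx by simp
    have "D \<sigma> x (D Z x w) = A (D Z x w) + (\<epsilon> * scal u (A x) (D Z x w)) *\<^sub>R x"
      by (rule covariant_derivative_killing[OF x levi_civita_tangent[OF connection Z x w]])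
    then have inner: "D \<sigma> x (D Z x w) =
        A (Z' w) + (\<epsilon> * scal u z w) *\<^sub>R A x + (\<epsilon> * scal u (A x) (Z' w)) *\<^sub>R x"
      by (simp add: DZ A_simps scal_simps)
    have "((\<lambda>y. A (Z y) + (\<epsilon> * scal u (A y) (Z y)) *\<^sub>R y) has_derivative
        (\<lambda>w. A (Z' w) + ((\<epsilon> * scal u (A x) (Z x)) *\<^sub>R w
          + (\<epsilon> * (scal u (A x) (Z' w) + scal u (A w) (Z x))) *\<^sub>R x))) (at x within M)"
      by (intro has_derivative_add has_derivative_scaleR has_derivative_mult_right scal.FDERIV
          A_has_derivative has_derivative_ident Z')
    then have V': "(V has_derivative
        (\<lambda>w. A (Z' w) + ((\<epsilon> * scal u (A x) (Z x)) *\<^sub>R w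
          + (\<epsilon> * (scal u (A x) (Z' w) + scal u (A w) (Z x))) *\<^sub>R x))) (at x within M)"
      by (rule has_derivative_transform_on[OF _ x V_eq])
    have "D V x w = A (Z' w) + ((\<epsilon> * scal u (A x) z) *\<^sub>R w
          + (\<epsilon> * (scal u (A x) (Z' w) + scal u (A w) z)) *\<^sub>R x) + (\<epsilon> * scal u (V x) w) *\<^sub>R x"
      using levi_civita_eq[OF connection V V' x w] Zx by simp
    moreover have "scal u (V x) w = - scal u (A w) z"
      using tangentD[OF w] skew[of z w] scal_commute[of u z "A w"]
      by (simp add: V_eq[OF x] Zx scal_simps)
    ultimately have outer: "D V x w = A (Z' w) + (\<epsilon> * scal u (A x) z) *\<^sub>R w
          + (\<epsilon> * scal u (A x) (Z' w)) *\<^sub>R x"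
      by (simp add: algebra_simps)
    show ?thesis
      using inner outer by (simp add: V_def)
  qed
  obtain Z where "vector_field u M Z" "Z x = z"
    using tangent_extension[OF x z] .
  with * show ?thesis
    unfolding second_cov_def by (intro the_equality) auto
qed

text \<open>
  The trace of the first summand of the Hessian is \<open>\<epsilon>Ax\<close>, that of the second \<open>\<epsilon>nAx\<close>, where
  \<open>n\<close>, the dimension of the quadric, is one less than that of the ambient space.
\<close>

lemma rough_laplacian_killing:
  assumes x: "x \<in> M"
  shows "rough_laplacian u M D \<sigma> x = (\<epsilon> * (real CARD('m) - 2)) *\<^sub>R A x"
proof -
  obtain B where B: "orthonormal_basis u (tangent u x) B"
    using tangent_basis_exists[OF x] .
  have "metric_trace u (tangent u x) (second_cov u M D \<sigma> x) =
      (\<Sum>b\<in>B. scal u b b *\<^sub>R ((\<epsilon> * scal u (A x) b) *\<^sub>R b - (\<epsilon> * scal u b b) *\<^sub>R A x))"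
    by (rule metric_trace_eq_sum[OF B])
      (auto intro!: linearI simp: second_cov_killing[OF x] scal_simps algebra_simps)
  also have "\<dots> = (\<Sum>b\<in>B. \<epsilon> *\<^sub>R ((scal u b b * scal u (A x) b) *\<^sub>R b) - \<epsilon> *\<^sub>R A x)"
    using B by (intro sum.cong) (auto simp: orthonormal_basis_def algebra_simps)
  also have "\<dots> = \<epsilon> *\<^sub>R A x - (real (card B) * \<epsilon>) *\<^sub>R A x"
    by (simp only: sum_subtractf sum_constant_scaleR scaleR_sum_right[symmetric]
        orthonormal_basis_expansion[OF B A_tangent, symmetric]) simp
  finally show ?thesis
    using card_tangent_basis[OF x B] by (simp add: rough_laplacian_def algebra_simps)
qed

text \<open>
  The term that is subtracted is the contribution of the unit normal \<open>x\<close> to \<open>\<langle>A, A\<rangle>\<close>.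
\<close>

lemma sum_tangent_basis_norm2_map:
  assumes x: "x \<in> M" and B: "orthonormal_basis u (tangent u x) B"
  shows "(\<Sum>b\<in>B. scal u b b * scal u (A b) (A b)) = norm2_map u A - \<epsilon> * scal u (A x) (A x)"
proof -
  have "norm2_map u A = \<epsilon> *\<^sub>R scal u (A x) (A x) + (\<Sum>b\<in>B. scal u b b *\<^sub>R scal u (A b) (A b))"
    unfolding norm2_map_def
    by (rule metric_trace_UNIV[OF x B]) (auto intro!: linearI simp: A_simps scal_simps)
  then show ?thesis
    by simp
qed

text \<open>
  Here \<open>\<epsilon>\<langle>Ax, Ax\<rangle>\<close> is lost twice: once because the normal direction is missing from the trace, and
  once because \<open>\<nabla>\<^sub>w\<sigma>\<close> is only the tangential part of \<open>Aw\<close>.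
\<close>

lemma norm2_cov_killing:
  assumes x: "x \<in> M"
  shows "norm2_cov u D \<sigma> x = norm2_map u A - 2 * \<epsilon> * scal u (A x) (A x)"
proof -
  obtain B where B: "orthonormal_basis u (tangent u x) B"
    using tangent_basis_exists[OF x] .
  have eq: "scal u (D \<sigma> x w) (D \<sigma> x z) =
      scal u (A w) (A z) - \<epsilon> * (scal u (A x) w * scal u (A x) z)"
    if "w \<in> tangent u x" "z \<in> tangent u x" for w z
  proof -
    have "scal u (A w) x = - scal u (A x) w" "scal u x (A z) = - scal u (A x) z"
      using skew[of w x] skew[of x z] scal_commute[of u w "A x"] by simp_all
    then show ?thesis
      using x that by (simp add: covariant_derivative_killing scal_simps scal_position algebra_simps)
  qed
  have "norm2_cov u D \<sigma> x =
      (\<Sum>b\<in>B. scal u b b *\<^sub>R (scal u (A b) (A b) - \<epsilon> * (scal u (A x) b * scal u (A x) b)))"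
    unfolding norm2_cov_def
    by (rule metric_trace_eq_sum[OF B])
      (auto intro!: linearI simp: eq A_simps scal_simps algebra_simps)
  also have "\<dots> = (\<Sum>b\<in>B. scal u b b * scal u (A b) (A b))
      - \<epsilon> * (\<Sum>b\<in>B. scal u b b * (scal u b (A x) * scal u b (A x)))"
    by (simp add: sum_subtractf sum_distrib_left algebra_simps scal_commute[of u "A x"])
  finally show ?thesis
    by (simp add: sum_tangent_basis_norm2_map[OF x B] sum_orthonormal_scal[OF B A_tangent])
qed

lemma half_norm2_killing: "x \<in> M \<Longrightarrow> half_norm2 u \<sigma> x = 1 / 2 * scal u (A x) (A x)"
  by (simp add: half_norm2_def on_M)

lemma gradient_tangent:
  "x \<in> M \<Longrightarrow> - A (A x) - (\<epsilon> * scal u (A x) (A x)) *\<^sub>R x \<in> tangent u x"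
  using skew[of x "A x"] by (simp add: tangent_def scal_simps scal_position)

text \<open>
  \<open>dF(w) = \<langle>Ax, Aw\<rangle> = - \<langle>A\<^sup>2x, w\<rangle>\<close>, and \<open>\<langle>A\<^sup>2x, x\<rangle> = - \<langle>Ax, Ax\<rangle>\<close> gives the normal
  correction.
\<close>

lemma grad_half_norm2_killing:
  assumes x: "x \<in> M"
  shows "grad u M (half_norm2 u \<sigma>) x = - A (A x) - (\<epsilon> * scal u (A x) (A x)) *\<^sub>R x"
proof -
  let ?g = "- A (A x) - (\<epsilon> * scal u (A x) (A x)) *\<^sub>R x"
  have sm: "smooth_fun M (half_norm2 u \<sigma>)"
    unfolding half_norm2_def [abs_def]
    by (rule smooth_fun_bilinear[OF bounded_bilinear_mult smooth_fun_const
          smooth_fun_bilinear[OF bounded_bilinear_scal]]) (rule vector_fieldD(1)[OF field])+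
  have "((\<lambda>y. 1 / 2 * scal u (A y) (A y)) has_derivative
      (\<lambda>w. 1 / 2 * (scal u (A x) (A w) + scal u (A w) (A x)))) (at x within M)"
    by (intro has_derivative_mult_right scal.FDERIV A_has_derivative has_derivative_ident)
  then have "(half_norm2 u \<sigma> has_derivative
      (\<lambda>w. 1 / 2 * (scal u (A x) (A w) + scal u (A w) (A x)))) (at x within M)"
    by (rule has_derivative_transform_on[OF _ x half_norm2_killing])
  note deriv = tderiv_eq[OF sm this x]
  have td: "tderiv M (half_norm2 u \<sigma>) x w = scal u ?g w"
    if "w \<in> tangent u x" for w
    using deriv[OF that] skew[of "A x" w] tangentD[OF that] scal_commute[of u "A w" "A x"]
    by (simp add: scal_simps)
  show ?thesis
    unfolding grad_def
  proof (rule the_equality)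
    show "?g \<in> tangent u x \<and> (\<forall>w\<in>tangent u x. scal u ?g w = tderiv M (half_norm2 u \<sigma>) x w)"
      using gradient_tangent[OF x] td by simp
    fix z
    assume z: "z \<in> tangent u x \<and> (\<forall>w\<in>tangent u x. scal u z w = tderiv M (half_norm2 u \<sigma>) x w)"
    have "z - ?g = 0"
    proof (rule tangent_nondegenerate[OF x])
      show "z - ?g \<in> tangent u x"
        using z gradient_tangent[OF x] subspace_tangent by (blast intro: subspace_diff)
      show "scal u (z - ?g) w = 0" if "w \<in> tangent u x" for w
        using z td[OF that] that by (simp add: scal.diff_left)
    qed
    then show "z = ?g"
      by simp
  qed
qed

text \<open>
  Only the terms \<open>- A\<^sup>2w - \<epsilon>\<langle>Ax, Ax\<rangle>w\<close> of the derivative of \<open>\<nabla>F\<close> have a tangential part; their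
  traces are \<open>\<langle>A, A\<rangle> - \<epsilon>\<langle>Ax, Ax\<rangle>\<close> and \<open>- \<epsilon>n\<langle>Ax, Ax\<rangle>\<close>.
\<close>

lemma laplacian_half_norm2_killing:
  assumes x: "x \<in> M"
  shows "laplacian u M D (half_norm2 u \<sigma>) x =
    \<epsilon> * real CARD('m) * scal u (A x) (A x) - norm2_map u A"
proof -
  define G where "G = grad u M (half_norm2 u \<sigma>)"
  define g where "g y = - A (A y) - (\<epsilon> * scal u (A y) (A y)) *\<^sub>R y" for y
  have Gg: "G y = g y" if "y \<in> M" for y
    using grad_half_norm2_killing[OF that] by (simp add: G_def g_def)
  have bA: "bounded_linear A"
    using linear_A by (simp add: linear_conv_bounded_linear)
  have "smooth_fun M (\<lambda>y. - A (A y) + scal u ((- \<epsilon>) *\<^sub>R A y) (A y) *\<^sub>R y)"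
    by (rule smooth_fun_add[OF smooth_fun_bounded_linear[OF bounded_linear_minus[OF
          bounded_linear_compose[OF bA bA]]] smooth_fun_bilinear[OF bounded_bilinear_scaleR
          smooth_fun_bilinear[OF bounded_bilinear_scal
            smooth_fun_bounded_linear[OF bounded_linear_const_scaleR[OF bA]]
            smooth_fun_bounded_linear[OF bA]]
          smooth_fun_bounded_linear[OF bounded_linear_ident]]])
  then have "smooth_fun M g"
    by (simp add: g_def [abs_def] scal_simps)
  then have G: "vector_field u M G"
    using smooth_fun_cong[of M G g, OF Gg] gradient_tangent
    by (simp add: vector_field_def Gg) (simp add: g_def)
  have "(g has_derivative (\<lambda>w. - A (A w) - ((\<epsilon> * scal u (A x) (A x)) *\<^sub>R w
      + (\<epsilon> * (scal u (A x) (A w) + scal u (A w) (A x))) *\<^sub>R x))) (at x within M)"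
    unfolding g_def [abs_def]
    by (intro has_derivative_diff has_derivative_minus has_derivative_scaleR
        has_derivative_mult_right scal.FDERIV A_has_derivative has_derivative_ident)
  then have G': "(G has_derivative (\<lambda>w. - A (A w) - ((\<epsilon> * scal u (A x) (A x)) *\<^sub>R w
      + (\<epsilon> * (scal u (A x) (A w) + scal u (A w) (A x))) *\<^sub>R x))) (at x within M)"
    by (rule has_derivative_transform_on[OF _ x Gg])
  have eq: "scal u (D G x w) z = scal u (A w) (A z) - \<epsilon> * scal u (A x) (A x) * scal u w z"
    if w: "w \<in> tangent u x" and z: "z \<in> tangent u x" for w z
    using tangentD[OF z] skew[of "A w" z]
    by (simp add: levi_civita_eq[OF connection G G' x w] scal_simps)
  obtain B where B: "orthonormal_basis u (tangent u x) B"
    using tangent_basis_exists[OF x] .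
  have "divergence u D G x =
      (\<Sum>b\<in>B. scal u b b *\<^sub>R (scal u (A b) (A b) - \<epsilon> * scal u (A x) (A x) * scal u b b))"
    unfolding divergence_def
    by (rule metric_trace_eq_sum[OF B])
      (auto intro!: linearI simp: eq A_simps scal_simps algebra_simps)
  also have "\<dots> = (\<Sum>b\<in>B. scal u b b * scal u (A b) (A b) - \<epsilon> * scal u (A x) (A x))"
    using B by (intro sum.cong) (auto simp: orthonormal_basis_def algebra_simps)
  also have "\<dots> = norm2_map u A - \<epsilon> * scal u (A x) (A x) - real (card B) * (\<epsilon> * scal u (A x) (A x))"
    by (simp add: sum_subtractf sum_tangent_basis_norm2_map[OF x B])
  finally show ?thesis
    using card_tangent_basis[OF x B] by (simp add: laplacian_def G_def algebra_simps)
qed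

lemma tau_killing:
  assumes x: "x \<in> M" and cube: "A (A (A x)) = lam *\<^sub>R A x"
    and F: "F = half_norm2 u \<sigma>" and dim: "CARD('m) = n + 1"
  shows "tau u M D p q \<sigma> x = (\<epsilon> * (real n + 1 - p) * q * (2 * F x)\<^sup>2
       + (\<epsilon> * (real n - 1 + (real n + 1) * q) - p * q * lam - q * norm2_map u A) * (2 * F x)
       + \<epsilon> * (real n - 1) - 2 * p * lam - (p + q) * norm2_map u A) *\<^sub>R A x"
proof -
  define t where "t = scal u (A x) (A x)"
  define G where "G = grad u M F x"
  have Ft: "half_norm2 u \<sigma> x = t / 2"
    using half_norm2_killing[OF x] by (simp add: t_def)
  have G: "G = - A (A x) - (\<epsilon> * t) *\<^sub>R x"
    using grad_half_norm2_killing[OF x] by (simp add: G_def F t_def)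
  have "D \<sigma> x G = A G + (\<epsilon> * scal u (A x) G) *\<^sub>R x"
    using covariant_derivative_killing[OF x gradient_tangent[OF x]] by (simp add: G t_def)
  then have DG: "D \<sigma> x G = (- lam - \<epsilon> * t) *\<^sub>R A x"
    by (simp add: G A_simps scal_simps cube algebra_simps)
  have "scal u (A (A x)) (A (A x)) = - lam * t"
    using skew[of "A x" "A (A x)"] by (simp add: cube scal_simps t_def)
  moreover have "scal u (A (A x)) x = - t" "scal u x (A (A x)) = - t"
    using skew[of "A x" x] skew[of x "A x"] by (simp_all add: t_def)
  ultimately have GG: "scal u G G = - lam * t - \<epsilon> * t\<^sup>2"
    by (simp add: G scal_simps scal_position[OF x] power2_eq_square algebra_simps)
  have "tau u M D p q \<sigma> x = ((1 + t) * (\<epsilon> * (real n - 1)) + 2 * p * (- lam - \<epsilon> * t)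
      - (p * (norm2_map u A - 2 * \<epsilon> * t) - p * q * (- lam * t - \<epsilon> * t\<^sup>2)
         - q * (1 + t) * (\<epsilon> * (real n + 1) * t - norm2_map u A))) *\<^sub>R A x"
    unfolding tau_def Let_def F[symmetric] G_def[symmetric] DG GG
    unfolding F rough_laplacian_killing[OF x] norm2_cov_killing[OF x]
      laplacian_half_norm2_killing[OF x] Ft on_M[OF x] t_def[symmetric] dim
    unfolding scaleR_scaleR scaleR_add_left[symmetric] scaleR_diff_left[symmetric]
    by (rule arg_cong2[where f = "(*\<^sub>R)", OF _ refl]) (simp add: algebra_simps)
  also have "(1 + t) * (\<epsilon> * (real n - 1)) + 2 * p * (- lam - \<epsilon> * t)
      - (p * (norm2_map u A - 2 * \<epsilon> * t) - p * q * (- lam * t - \<epsilon> * t\<^sup>2)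
         - q * (1 + t) * (\<epsilon> * (real n + 1) * t - norm2_map u A))
    = \<epsilon> * (real n + 1 - p) * q * t\<^sup>2
       + (\<epsilon> * (real n - 1 + (real n + 1) * q) - p * q * lam - q * norm2_map u A) * t
       + \<epsilon> * (real n - 1) - 2 * p * lam - (p + q) * norm2_map u A"
    by (simp add: algebra_simps power2_eq_square)
  finally show ?thesis
    by (simp add: F Ft)
qed

text \<open>
  The zeros of a nonzero Killing field have no interior: at a zero \<open>x\<close> choose a tangent \<open>w\<close> with
  \<open>Aw \<noteq> 0\<close>. On the curve through \<open>x\<close> in this direction \<open>A\<close> takes nonzero multiples of
  \<open>A(x + tw) = tAw\<close>, so \<open>P\<close> vanishes along it for \<open>t \<noteq> 0\<close>.
\<close>

lemma continuous_eq_0_at_zeros: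
  fixes P :: "'m ambient \<Rightarrow> real"
  assumes nontrivial: "\<exists>y. A y \<noteq> 0" and P: "continuous_on UNIV P"
    and 0: "\<And>y. y \<in> M \<Longrightarrow> A y \<noteq> 0 \<Longrightarrow> P y = 0" and x: "x \<in> M"
  shows "P x = 0"
proof (cases "A x = 0")
  case True
  obtain y where y: "A y \<noteq> 0"
    using nontrivial by blast
  define w where "w = y - (\<epsilon> * scal u x y) *\<^sub>R x"
  have w: "w \<in> tangent u x"
    unfolding w_def by (rule tangential_part[OF x])
  have Aw: "A w \<noteq> 0"
    using y True by (simp add: w_def A_simps)
  obtain c S where c: "open S" "(0::real) \<in> S" "\<And>t. t \<in> S \<Longrightarrow> c t \<in> M" "c 0 = x"
    "\<And>t. t \<in> S \<Longrightarrow> \<exists>s. s \<noteq> 0 \<and> c t = s *\<^sub>R (x + t *\<^sub>R w)"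
    "(c has_derivative (\<lambda>t. t *\<^sub>R w)) (at 0)"
    by (rule tangent_curve[OF x w]) (rule that; assumption)
  have "P (c t) = 0" if t: "t \<in> S" "t \<noteq> 0" for t
  proof (rule 0)
    obtain s where "c t = s *\<^sub>R (x + t *\<^sub>R w)" "s \<noteq> 0"
      using c(5)[OF t(1)] by blast
    then show "A (c t) \<noteq> 0"
      using that Aw True by (simp add: A_simps)
  qed (use c that in auto)
  then have "eventually (\<lambda>t. P (c t) = 0) (at 0)"
    unfolding eventually_at_topological using c(1,2) by blast
  then have "((\<lambda>t. P (c t)) \<longlongrightarrow> 0) (at 0)"
    by (rule tendsto_eventually)
  moreover have "isCont (\<lambda>t. P (c t)) 0"
    using has_derivative_continuous[OF c(6)] P
    by (intro continuous_at_compose[of 0 c P, unfolded o_def])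
      (auto simp: continuous_on_eq_continuous_at)
  then have "((\<lambda>t. P (c t)) \<longlongrightarrow> P x) (at 0)"
    using c(4) by (simp add: isCont_def)
  ultimately show ?thesis
    using tendsto_unique[of "at (0::real)"] by auto
qed (use 0 x in auto)

end


section \<open>Characterisation of \<open>(p,q)\<close>-harmonicity\<close>

theorem theorem6p5:
  fixes n v u :: nat
    and \<epsilon> lam p q :: real
    and M :: "'m::{finite,linorder} ambient set"
    and D :: "'m connection"
    and \<sigma> \<sigma>hat A :: "'m ambient \<Rightarrow> 'm ambient"
    and F :: "'m ambient \<Rightarrow> real"
  assumes dim: "CARD('m) = n + 1" "n \<ge> 2" "v \<le> n"
    and hyperquadric:
      "(\<epsilon> = 1 \<and> u = v \<and> M = pseudo_sphere v) \<or> (\<epsilon> = - 1 \<and> u = v + 1 \<and> M = pseudo_hyperbolic v)"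
    and connection: "levi_civita u M D"
    and killing: "killing_field u M \<sigma>"
    and nontrivial: "\<exists>x\<in>M. \<sigma> x \<noteq> 0"
    and preharmonic: "preharmonic u M D \<sigma>"
    and extension: "linear_extension u M \<sigma> A"
    and F: "F = half_norm2 u \<sigma>"
    and hat: "linear_extension u M \<sigma>hat (A ^^ 3)"
    and lam: "\<forall>x\<in>M. \<sigma>hat x = lam *\<^sub>R \<sigma> x"
  shows "pq_harmonic u M D p q \<sigma> \<longleftrightarrow>
    (\<forall>x\<in>M. 0 = \<epsilon> * (real n + 1 - p) * q * (2 * F x)\<^sup>2
       + (\<epsilon> * (real n - 1 + (real n + 1) * q) - p * q * lam - q * norm2_map u A) * (2 * F x)
       + \<epsilon> * (real n - 1) - 2 * p * lam - (p + q) * norm2_map u A)"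
proof -
  interpret hyperquadric u \<epsilon> M
    using hyperquadric
    by unfold_locales (auto simp: pseudo_sphere_def pseudo_hyperbolic_def)
  interpret killing_extension u \<epsilon> M D \<sigma> A
    using connection killing extension
    by unfold_locales (auto simp: killing_field_def)
  have cube: "A (A (A x)) = lam *\<^sub>R A x" if "x \<in> M" for x
  proof -
    have "\<sigma>hat x = A (A (A x))"
      using hat that by (simp add: linear_extension_def numeral_3_eq_3)
    then show ?thesis
      using lam that on_M[OF that] by simp
  qed
  define P where "P t = \<epsilon> * (real n + 1 - p) * q * t\<^sup>2
       + (\<epsilon> * (real n - 1 + (real n + 1) * q) - p * q * lam - q * norm2_map u A) * t
       + \<epsilon> * (real n - 1) - 2 * p * lam - (p + q) * norm2_map u A" for t
  have tau: "tau u M D p q \<sigma> x = P (2 * F x) *\<^sub>R A x" if "x \<in> M" for x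
    unfolding P_def by (rule tau_killing[OF that cube[OF that] F dim(1)])
  have F_eq: "2 * F x = scal u (A x) (A x)" if "x \<in> M" for x
    by (simp add: F half_norm2_killing[OF that])
  have "pq_harmonic u M D p q \<sigma> \<longleftrightarrow> (\<forall>x\<in>M. 0 = P (2 * F x))"
  proof
    assume "pq_harmonic u M D p q \<sigma>"
    then have 0: "P (scal u (A x) (A x)) = 0" if "x \<in> M" "A x \<noteq> 0" for x
      using tau[OF that(1)] that F_eq[OF that(1)] by (auto simp: pq_harmonic_def)
    have ne: "\<exists>x. A x \<noteq> 0"
      using nontrivial on_M by metis
    have "continuous_on UNIV A"
      using linear_A by (simp add: linear_continuous_on linear_conv_bounded_linear)
    then have "continuous_on UNIV (\<lambda>x. P (scal u (A x) (A x)))"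
      unfolding P_def by (intro continuous_intros scal.continuous_on)
    then have "P (scal u (A x) (A x)) = 0" if "x \<in> M" for x
      by (rule continuous_eq_0_at_zeros[OF ne _ 0 that])
    then show "\<forall>x\<in>M. 0 = P (2 * F x)"
      using F_eq by simp
  next
    assume "\<forall>x\<in>M. 0 = P (2 * F x)"
    then show "pq_harmonic u M D p q \<sigma>"
      using tau by (simp add: pq_harmonic_def)
  qed
  then show ?thesis
    unfolding P_def .
qed

end
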